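(* Let $m\ge 2$ and $a\ge 1$ be integers and $n=m^a$. Let $\mathcal{S}_{m,n}$ be the set of pairs $(\omega,\omega')$ of $n\times n$ density matrices such that $$\omega\otimes \tfrac{1}{m}\mathbb{I}_m \succ \omega'\otimes |0\rangle\langle 0|,$$ and let $d_{m,n}=\min\{ d(\omega,\omega') : (\omega,\omega')\in\mathcal{S}_{m,n}\}$. Then $$d_{m,n}=\frac{m-1}{1+(m-1)a}=\frac{m-1}{1+(m-1)\log_m n}.$$ Moreover, the minimum is attained by the following diagonal pair (in a fixed orthonormal basis $\{|i\rangle\}_{i=1}^n$): $\omega'=\sum_{i=1}^n\omega'_i|i\rangle\langle i|$ with $\omega'_1=\frac{1}{1+(m-1)a}$ and $\omega'_i=\omega'_1\, m^{1-\lceil \log_m i\rceil}$ for $1\le i\le n$; and $\omega=\sum_{i=1}^n\omega_i|i\rangle\langle i|$ with $\omega_1=m\,\omega'_1$, $\omega_i=\omega'_i$ for $2\le i\le n/m$, and $\omega_i=0$ for $i>n/m$.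
   Context: For density matrices $\rho,\sigma$ (possibly of different dimensions), $\rho\succ\sigma$ means that the vector of eigenvalues of $\rho$ majorizes that of $\sigma$, after padding the shorter vector with zeros: if $\lambda^\downarrow$ denotes eigenvalues in non-increasing order, then $\sum_{i=1}^k\lambda_i^\downarrow(\rho)\ge\sum_{i=1}^k\lambda_i^\downarrow(\sigma)$ for all $k$ (with equality of total sums, both being $1$). Here $\omega\otimes\frac{1}{m}\mathbb{I}_m$ and $\omega'\otimes|0\rangle\langle 0|$ are $nm\times nm$ density matrices, $|0\rangle$ a unit vector in $\mathbb{C}^m$. The trace distance is $d(\omega,\omega')=\frac12\|\omega-\omega'\|_1$.
   Formalization: The formula ω'_i = ω'_1 m^{1-⌈log_m i⌉} is taken only for 2 ≤ i ≤ n, since at i = 1 it would give ω'_1 = m ω'_1; at i = 1 the stated value ω'_1 = 1/(1+(m-1)a) is used. *)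

theory Defs
  imports "Jordan_Normal_Form.Schur_Decomposition" "Jordan_Normal_Form.Char_Poly"
    "HOL-Library.Multiset"
begin

definition mtrace :: "complex mat \<Rightarrow> complex" where
  "mtrace A = (\<Sum>i<dim_row A. A $$ (i, i))"

definition density_mat :: "nat \<Rightarrow> complex mat \<Rightarrow> bool" where
  "density_mat n \<rho> \<longleftrightarrow> \<rho> \<in> carrier_mat n n \<and> mat_adjoint \<rho> = \<rho>
     \<and> (\<forall>v \<in> carrier_vec n. Re (conjugate v \<bullet> (\<rho> *\<^sub>v v)) \<ge> 0)
     \<and> mtrace \<rho> = 1"

definition kron :: "complex mat \<Rightarrow> complex mat \<Rightarrow> complex mat" where
  "kron A B = mat (dim_row A * dim_row B) (dim_col A * dim_col B)
     (\<lambda>(i, j). A $$ (i div dim_row B, j div dim_col B) * B $$ (i mod dim_row B, j mod dim_col B))"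

definition ket0_proj :: "nat \<Rightarrow> complex mat" where
  "ket0_proj m = mat m m (\<lambda>(i, j). if i = 0 \<and> j = 0 then 1 else 0)"

(* eigenvalues (with multiplicity, as roots of the characteristic polynomial),
   real parts, in non-increasing order; for Hermitian matrices they are real *)
definition eigs_desc :: "complex mat \<Rightarrow> real list" where
  "eigs_desc A = rev (sorted_list_of_multiset (image_mset Re (proots (char_poly A))))"

definition pad_nth :: "real list \<Rightarrow> nat \<Rightarrow> real" where
  "pad_nth xs i = (if i < length xs then xs ! i else 0)"

definition majorizes :: "complex mat \<Rightarrow> complex mat \<Rightarrow> bool" where
  "majorizes \<rho> \<sigma> \<longleftrightarrow>
     (\<forall>k. (\<Sum>i<k. pad_nth (eigs_desc \<sigma>) i) \<le> (\<Sum>i<k. pad_nth (eigs_desc \<rho>) i))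
     \<and> sum_list (eigs_desc \<rho>) = sum_list (eigs_desc \<sigma>)"

definition trace_norm_herm :: "complex mat \<Rightarrow> real" where
  "trace_norm_herm A = sum_list (map abs (eigs_desc A))"

(* trace distance d(w,w') = 1/2 ||w - w'||_1 (w - w' is Hermitian for density matrices) *)
definition trace_dist :: "complex mat \<Rightarrow> complex mat \<Rightarrow> real" where
  "trace_dist \<omega> \<omega>' = trace_norm_herm (\<omega> - \<omega>') / 2"

end

(* Let P k and Q k be the sums of the k largest eigenvalues of w and w', and let d be their trace
   distance. Splitting each eigenvalue of w into m equal parts, the majorization says
   Q (k m) <= P k for all k and m Q 1 <= P 1. Ky Fan's principle (evaluate w - w' on the span of the
   top k eigenvectors of w) gives P k <= Q k + d. Iterating along k = 1, m, m^2, ... yields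
   1 = Q (m^a) <= Q 1 + a d, while (m - 1) Q 1 <= P 1 - Q 1 <= d; together
   m - 1 <= d (1 + (m - 1) a). For the extremal pair the two Kronecker products have the same
   spectrum. *)

theory Submission
  imports Defs
begin

section \<open>Unitary diagonalization of Hermitian matrices\<close>

text \<open>The hypothesis n = m^a makes the chain 1, m, m^2, ... end exactly at n, where Q is the
  whole trace. Tightness of every inequality suggests the extremal pair: from m^j to m^(j+1) the sum
  Q must grow by exactly d, and spreading d evenly over the (m - 1) m^j new entries gives the value
  w'_1 m^(-j), with d = (m - 1) w'_1. Normalization then yields w'_1 = 1 / (1 + (m - 1) a). The
  obstacle is that \<open>eigs_desc\<close> is a sorted list of real parts of roots of a polynomial,
  whereas Ky Fan's principle needs an orthonormal eigenbasis listed in that very order. Hence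
  unitary diagonalization is proved for every ordering of the roots. Conversely, the spectra of
  Kronecker products and of diagonal matrices are found by factoring the characteristic polynomial,
  which depends only on the multiset of eigenvalues.\<close>

lemma adjoint_carrier[simp]: "A \<in> carrier_mat nr nc \<Longrightarrow> mat_adjoint A \<in> carrier_mat nc nr"
  by (auto simp: mat_adjoint_def mat_of_rows_def)

lemma adjoint_dims[simp]: "dim_row (mat_adjoint A) = dim_col A" "dim_col (mat_adjoint A) = dim_row A"
  by (auto simp: mat_adjoint_def mat_of_rows_def)

lemma adjoint_index[simp]:
  fixes A :: "complex mat"
  assumes "i < dim_col A" "j < dim_row A"
  shows "mat_adjoint A $$ (i, j) = cnj (A $$ (j, i))"
  using assms by (simp add: mat_adjoint_def mat_of_rows_def)

lemma adjoint_adjoint[simp]: "mat_adjoint (mat_adjoint A) = (A :: complex mat)"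
  by (rule eq_matI) auto

lemma adjoint_mult:
  fixes A B :: "complex mat"
  assumes "A \<in> carrier_mat nr n" "B \<in> carrier_mat n nc"
  shows "mat_adjoint (A * B) = mat_adjoint B * mat_adjoint A"
  using assms by (intro eq_matI) (auto simp: scalar_prod_def mult.commute)

lemma adjoint_minus:
  fixes A B :: "complex mat"
  assumes "A \<in> carrier_mat nr nc" "B \<in> carrier_mat nr nc"
  shows "mat_adjoint (A - B) = mat_adjoint A - mat_adjoint B"
  using assms by (intro eq_matI) auto

lemma mult_mat_entry:
  assumes "A \<in> carrier_mat nr n" "B \<in> carrier_mat n nc" "i < nr" "j < nc"
  shows "(A * B) $$ (i, j) = (\<Sum>l<n. A $$ (i, l) * B $$ (l, j))"
  using assms by (auto simp: scalar_prod_def atLeast0LessThan)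

lemma conjugation_mult:
  fixes A U V :: "complex mat"
  assumes [simp]: "A \<in> carrier_mat n n" "U \<in> carrier_mat n n" "V \<in> carrier_mat n n"
  shows "mat_adjoint (U * V) * A * (U * V) = mat_adjoint V * (mat_adjoint U * A * U) * V"
proof -
  have [simp]: "X * Y \<in> carrier_mat n n" if "X \<in> carrier_mat n n" "Y \<in> carrier_mat n n" for X Y :: "complex mat"
    using that by (rule mult_carrier_mat)
  show ?thesis
    unfolding adjoint_mult[OF assms(2,3)] by (simp add: assoc_mult_mat[of _ n n _ n _ n])
qed

lemma hermitian_conjugation:
  fixes A U :: "complex mat"
  assumes A: "A \<in> carrier_mat n n" and U: "U \<in> carrier_mat n n" and herm: "mat_adjoint A = A"
  shows "mat_adjoint (mat_adjoint U * A * U) = mat_adjoint U * A * U"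
proof -
  note aU = adjoint_carrier[OF U]
  show ?thesis
    unfolding adjoint_mult[OF mult_carrier_mat[OF aU A] U] adjoint_mult[OF aU A] adjoint_adjoint herm
    by (rule assoc_mult_mat[OF aU A U, symmetric])
qed

definition unitary_mat :: "nat \<Rightarrow> complex mat \<Rightarrow> bool" where
  "unitary_mat n U \<longleftrightarrow> U \<in> carrier_mat n n \<and> mat_adjoint U * U = 1\<^sub>m n \<and> U * mat_adjoint U = 1\<^sub>m n"

lemma unitary_matI:
  assumes "U \<in> carrier_mat n n" "mat_adjoint U * U = 1\<^sub>m n"
  shows "unitary_mat n U"
  using assms mat_mult_left_right_inverse[of "mat_adjoint U" n U] by (auto simp: unitary_mat_def)

lemma unitary_mat_carrier: "unitary_mat n U \<Longrightarrow> U \<in> carrier_mat n n"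
  by (simp add: unitary_mat_def)

lemma unitary_mat_adjoint: "unitary_mat n U \<Longrightarrow> unitary_mat n (mat_adjoint U)"
  by (auto simp: unitary_mat_def)

lemma unitary_mat_mult:
  assumes "unitary_mat n U" "unitary_mat n V"
  shows "unitary_mat n (U * V)"
proof (rule unitary_matI)
  have c[simp]: "U \<in> carrier_mat n n" "V \<in> carrier_mat n n" using assms by (auto simp: unitary_mat_def)
  show "U * V \<in> carrier_mat n n" by (rule mult_carrier_mat[OF c])
  have "mat_adjoint (U * V) * (U * V) = mat_adjoint V * (mat_adjoint U * (U * V))"
    by (simp add: adjoint_mult[OF c] assoc_mult_mat[of _ n n _ n _ n] mult_carrier_mat[OF c])
  also have "mat_adjoint U * (U * V) = mat_adjoint U * U * V"
    by (simp add: assoc_mult_mat[of _ n n _ n _ n])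
  also have "\<dots> = V" using assms(1) by (simp add: unitary_mat_def left_mult_one_mat[OF c(2)])
  finally show "mat_adjoint (U * V) * (U * V) = 1\<^sub>m n" using assms(2) by (simp add: unitary_mat_def)
qed

text \<open>Gram-Schmidt applied to a basis that starts with \<open>v\<close> keeps \<open>v\<close>
  as its first vector. Normalizing the columns rescales it, which is why an unspecified factor
  \<open>c\<close> appears.\<close>

lemma unitary_mat_first_column:
  fixes v :: "complex vec"
  assumes v: "v \<in> carrier_vec n" and v0: "v \<noteq> 0\<^sub>v n"
  obtains U c where "unitary_mat n U" "col U 0 = c \<cdot>\<^sub>v v"
proof -
  interpret cof_vec_space n "TYPE(complex)" .
  define b where "b = basis_completion v"
  define ws where "ws = gram_schmidt n b"
  from basis_completion[OF v v0, folded b_def]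
  have dist_b: "distinct b" and indep: "\<not> lin_dep (set b)" and b: "set b \<subseteq> carrier_vec n"
    and hdb: "hd b = v" and len_b: "length b = n" by auto
  from v v0 have n: "n \<noteq> 0" by auto
  from hdb len_b n obtain vs where bv: "b = v # vs" by (cases b, auto)
  from gram_schmidt_result[OF b dist_b indep refl, folded ws_def]
  have ws: "set ws \<subseteq> carrier_vec n" "corthogonal ws" "length ws = n"
    by (auto simp: len_b)
  have hdws: "hd ws = v" using gram_schmidt_hd[OF v, of vs, folded bv] by (simp add: ws_def)
  \<comment> \<open>\<open>gram_schmidt\<close> yields pairwise orthogonal nonzero vectors that are
    not normalized; \<open>r j\<close> is the norm by which column \<open>j\<close> gets
    divided.\<close>
  define r where "r j = sqrt (\<Sum>i<n. (cmod (ws ! j $ i))\<^sup>2)" for j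
  have wsc: "ws ! j \<in> carrier_vec n" if "j < n" for j using ws that by auto
  have sp: "ws ! j \<bullet>c ws ! l = (\<Sum>i<n. ws ! j $ i * cnj (ws ! l $ i))" if "j < n" "l < n" for j l
    using wsc[OF that(1)] wsc[OF that(2)] by (simp add: scalar_prod_def atLeast0LessThan)
  have r2: "ws ! j \<bullet>c ws ! j = complex_of_real ((r j)\<^sup>2)" if "j < n" for j
    unfolding sp[OF that that] r_def
    by (simp add: sum_nonneg complex_norm_square of_real_power[symmetric] del: of_real_power)
  have r0: "r j \<noteq> 0" if "j < n" for j
    using corthogonalD[OF ws(2), of j j] r2[OF that] that ws by auto
  define U where "U = mat n n (\<lambda>(i, j). ws ! j $ i / complex_of_real (r j))"
  have U: "U \<in> carrier_mat n n" by (simp add: U_def)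
  have "mat_adjoint U * U = 1\<^sub>m n"
  proof (rule eq_matI)
    fix i j assume "i < dim_row (1\<^sub>m n :: complex mat)" "j < dim_col (1\<^sub>m n :: complex mat)"
    hence i: "i < n" and j: "j < n" by auto
    have "(mat_adjoint U * U) $$ (i, j) = (\<Sum>l<n. cnj (U $$ (l, i)) * U $$ (l, j))"
      using U i j by (subst mult_mat_entry[of _ n n _ n]) auto
    also have "\<dots> = (ws ! j \<bullet>c ws ! i) / (complex_of_real (r i) * complex_of_real (r j))"
      unfolding sp[OF j i] sum_divide_distrib using i j
      by (intro sum.cong) (auto simp: U_def field_simps)
    also have "\<dots> = 1\<^sub>m n $$ (i, j)"
    proof (cases "i = j")
      case True
      then show ?thesis using r2[OF i] r0[OF i] i by (simp add: power2_eq_square)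
    next
      case False
      then show ?thesis using corthogonalD[OF ws(2), of j i] i j ws by auto
    qed
    finally show "(mat_adjoint U * U) $$ (i, j) = 1\<^sub>m n $$ (i, j)" .
  qed (use U in auto)
  hence "unitary_mat n U" using U by (rule unitary_matI[rotated])
  moreover have "ws ! 0 = v" using hdws ws n by (cases ws) auto
  hence "col U 0 = (1 / complex_of_real (r 0)) \<cdot>\<^sub>v v"
    using v n by (intro eq_vecI) (auto simp: U_def)
  ultimately show ?thesis by (rule that)
qed

lemma mult_block_diag:
  fixes A B C D :: "'a :: comm_ring_1 mat"
  assumes "A \<in> carrier_mat n n" "B \<in> carrier_mat n n" "C \<in> carrier_mat k k" "D \<in> carrier_mat k k"
  shows "four_block_mat A (0\<^sub>m n k) (0\<^sub>m k n) C * four_block_mat B (0\<^sub>m n k) (0\<^sub>m k n) D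
    = four_block_mat (A * B) (0\<^sub>m n k) (0\<^sub>m k n) (C * D)"
proof -
  have "A * B \<in> carrier_mat n n" "C * D \<in> carrier_mat k k"
    by (auto intro: mult_carrier_mat assms)
  thus ?thesis
    by (subst mult_four_block_mat[of _ n n _ k _ k _ _ n _ k]) (use assms in auto)
qed

text \<open>Deflation: a unitary whose first column is an eigenvector for \<open>e\<close> splits
  off a 1 x 1 block, and the rest is Hermitian with the remaining roots. Since the roots are split
  off in the order of \<open>es\<close>, the diagonal comes out in any order in which the linear
  factors are written.\<close>

lemma hermitian_unitary_diagonalization:
  fixes A :: "complex mat"
  assumes "A \<in> carrier_mat n n" "mat_adjoint A = A" "char_poly A = (\<Prod>e\<leftarrow>es. [:- e, 1:])"
  shows "\<exists>U. unitary_mat n U \<and> mat_adjoint U * A * U = mat_diag n (\<lambda>i. es ! i)"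
  using assms
proof (induction es arbitrary: n A)
  case Nil
  with degree_monic_char_poly[of A n] have "n = 0" by auto
  then show ?case using Nil
    by (intro exI[of _ "1\<^sub>m 0"] conjI unitary_matI eq_matI) (auto simp: mat_diag_def)
next
  case (Cons e es n A)
  note A = Cons.prems(1)
  from Cons.prems(3) have e: "eigenvalue A e"
    unfolding eigenvalue_root_char_poly[OF A] by simp
  have cp: "char_poly A = [:- e, 1:] * (\<Prod>e\<leftarrow>es. [:- e, 1:])" using Cons.prems(3) by simp
  have mon: "monic (\<Prod>e\<leftarrow>es. [:- e, 1:])" by (rule monic_prod_list) auto
  have "degree (char_poly A) = Suc (degree (\<Prod>e\<leftarrow>es. [:- e, 1:]))"
    unfolding cp by (subst degree_mult_eq) (use mon in auto)
  with degree_monic_char_poly[OF A] obtain k where n: "n = Suc k" by metis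
  from e obtain v where v: "v \<in> carrier_vec n" "v \<noteq> 0\<^sub>v n" "A *\<^sub>v v = e \<cdot>\<^sub>v v"
    using A by (auto simp: eigenvalue_def eigenvector_def)
  from unitary_mat_first_column[OF v(1,2)] obtain U c where
    U: "unitary_mat n U" and colU: "col U 0 = c \<cdot>\<^sub>v v" .
  have Uc[simp]: "U \<in> carrier_mat n n" using U by (simp add: unitary_mat_def)
  have aUc[simp]: "mat_adjoint U \<in> carrier_mat n n" by simp
  note Ac[simp] = A
  have UAc[simp]: "mat_adjoint U * A \<in> carrier_mat n n" by (rule mult_carrier_mat[OF aUc A])
  define A' where "A' = mat_adjoint U * A * U"
  have A'c[simp]: "A' \<in> carrier_mat n n" unfolding A'_def by (rule mult_carrier_mat[OF UAc Uc])
  have A'h: "mat_adjoint A' = A'"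
    unfolding A'_def by (rule hermitian_conjugation[OF A Uc Cons.prems(2)])
  have A'0: "A' $$ (i, 0) = (if i = 0 then e else 0)" if i: "i < n" for i
  proof -
    have "A' $$ (i, 0) = row (mat_adjoint U) i \<bullet> col (A * U) 0"
      unfolding A'_def assoc_mult_mat[OF aUc A Uc] using i n Uc A by (subst index_mult_mat) auto
    also have "col (A * U) 0 = A *\<^sub>v col U 0" using Uc A n by (intro col_mult2[of _ n n _ n]) auto
    also have "\<dots> = e \<cdot>\<^sub>v col U 0"
      unfolding colU using v A by (simp add: mult_mat_vec[OF A] smult_smult_assoc mult.commute)
    also have "row (mat_adjoint U) i \<bullet> (e \<cdot>\<^sub>v col U 0) = e * (row (mat_adjoint U) i \<bullet> col U 0)"
      by (rule scalar_prod_smult_distrib[of _ n]) (use aUc i in \<open>auto simp: colU v\<close>)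
    also have "row (mat_adjoint U) i \<bullet> col U 0 = (mat_adjoint U * U) $$ (i, 0)"
      using Uc i n by (subst index_mult_mat) auto
    also have "\<dots> = (if i = 0 then 1 else 0)" using U i n by (simp add: unitary_mat_def)
    finally show ?thesis by simp
  qed
  define B where "B = mat k k (\<lambda>(i, j). A' $$ (Suc i, Suc j))"
  have Bc[simp]: "B \<in> carrier_mat k k" by (simp add: B_def)
  let ?E = "mat 1 1 (\<lambda>_. e) :: complex mat"
  \<comment> \<open>The eigenvector clears only the first column; Hermitian symmetry carries this
    over to the first row, so the matrix is block diagonal and not merely block triangular.\<close>
  have A'0': "A' $$ (0, j) = (if j = 0 then e else 0)" if j: "j < n" for j
  proof (cases "j = 0")
    case False
    have "A' $$ (0, j) = mat_adjoint A' $$ (0, j)" by (simp add: A'h)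
    also have "\<dots> = cnj (A' $$ (j, 0))" using A'c j n by (subst adjoint_index) auto
    finally show ?thesis using A'0[OF j] False by simp
  qed (use A'0[of 0] n in auto)
  have A'B: "A' = four_block_mat ?E (0\<^sub>m 1 k) (0\<^sub>m k 1) B"
    using A'0 A'0' A'c n by (intro eq_matI) (auto simp: B_def)
  have Bh: "mat_adjoint B = B"
  proof (rule eq_matI)
    fix i j assume ij: "i < dim_row B" "j < dim_col B"
    have "A' $$ (Suc i, Suc j) = mat_adjoint A' $$ (Suc i, Suc j)" by (simp add: A'h)
    also have "\<dots> = cnj (A' $$ (Suc j, Suc i))" 
      using A'c n ij by (subst adjoint_index) (auto simp: B_def)
    finally show "mat_adjoint B $$ (i, j) = B $$ (i, j)" using ij by (auto simp: B_def)
  qed (auto simp: B_def)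
  have "similar_mat A' A"
    by (rule similar_matI[of _ _ "mat_adjoint U" U n]) (use U in \<open>auto simp: A'_def[symmetric] unitary_mat_def\<close>)
  hence "char_poly A = char_poly A'" by (simp add: char_poly_similar)
  also have "\<dots> = char_poly ?E * char_poly B" unfolding A'B
    by (rule char_poly_four_block_zeros_col) auto
  also have "char_poly ?E = [: -e, 1 :]"
    by (simp add: char_poly_defs det_def sign_def)
  finally have "char_poly B = (\<Prod>e\<leftarrow>es. [:- e, 1:])"
    using cp by (metis mult_cancel_left pCons_eq_0_iff zero_neq_one)
  from Cons.IH[OF Bc Bh this] obtain V where V: "unitary_mat k V"
    and VB: "mat_adjoint V * B * V = mat_diag k (\<lambda>i. es ! i)" by auto
  have Vc[simp]: "V \<in> carrier_mat k k" using V by (simp add: unitary_mat_def)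
  let ?V = "four_block_mat (1\<^sub>m 1) (0\<^sub>m 1 k) (0\<^sub>m k 1) V"
  have aV: "mat_adjoint ?V = four_block_mat (1\<^sub>m 1) (0\<^sub>m 1 k) (0\<^sub>m k 1) (mat_adjoint V)"
    using Vc by (intro eq_matI) (auto simp del: Vc)
  have "mat_adjoint ?V * ?V = 1\<^sub>m n"
    unfolding aV using V n
    by (subst mult_block_diag) (auto simp: unitary_mat_def four_block_one_mat)
  hence uV: "unitary_mat n ?V" using n Vc by (intro unitary_matI) (auto simp del: Vc)
  have Vc'[simp]: "?V \<in> carrier_mat n n" using uV by (simp add: unitary_mat_def)
  have "mat_adjoint (U * ?V) * A * (U * ?V) = mat_adjoint ?V * A' * ?V"
    unfolding A'_def by (rule conjugation_mult[OF A Uc Vc'])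
  also have "\<dots> = four_block_mat ?E (0\<^sub>m 1 k) (0\<^sub>m k 1) (mat_adjoint V * B * V)"
    unfolding aV A'B
    by (simp add: mult_block_diag mult_carrier_mat[of _ k k _ k] left_mult_one_mat[of _ 1 1] right_mult_one_mat[of _ 1 1])
  also have "\<dots> = mat_diag n (\<lambda>i. (e # es) ! i)"
    unfolding VB n by (intro eq_matI) (auto simp: mat_diag_def)
  finally show ?case using unitary_mat_mult[OF U uV] by blast
qed

section \<open>Characteristic polynomials and sorted real spectra\<close>

lemma mat_diag_index[simp]: "i < n \<Longrightarrow> j < n \<Longrightarrow> mat_diag n f $$ (i, j) = (if i = j then f j else 0)"
  by (simp add: mat_diag_def)

lemma mat_diag_dims[simp]: "dim_row (mat_diag n f) = n" "dim_col (mat_diag n f) = n"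
  by (simp_all add: mat_diag_def)

lemma char_poly_mat_diag:
  "char_poly (mat_diag n f :: complex mat) = (\<Prod>a\<leftarrow>map f [0..<n]. [:- a, 1:])"
proof -
  have "diag_mat (mat_diag n f) = map f [0..<n]" by (simp add: diag_mat_def)
  moreover have "upper_triangular (mat_diag n f)" by (auto simp: upper_triangular_def)
  ultimately show ?thesis using char_poly_upper_triangular[OF mat_diag_dim] by metis
qed

lemma proots_linear_factors: "proots (\<Prod>a\<leftarrow>as. [:- a, 1:]) = mset (as :: complex list)"
proof (induction as)
  case (Cons a as)
  have "(\<Prod>a\<leftarrow>as. [:- a, 1:]) \<noteq> 0" by (auto simp: prod_list_zero_iff)
  then show ?case using Cons by (simp add: proots_mult del: mult_pCons_left mult_pCons_right)
qed simp

lemma eigs_desc_mset: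
  assumes "char_poly A = (\<Prod>a\<leftarrow>map complex_of_real xs. [:- a, 1:])"
  shows "mset (eigs_desc A) = mset xs"
  unfolding eigs_desc_def assms proots_linear_factors by (simp add: multiset.map_comp o_def)

lemma eigs_desc_eqI:
  assumes "char_poly A = (\<Prod>a\<leftarrow>map complex_of_real xs. [:- a, 1:])" "sorted_wrt (\<ge>) xs"
  shows "eigs_desc A = xs"
proof -
  have "eigs_desc A = rev (sort xs)"
    unfolding eigs_desc_def assms proots_linear_factors by (simp add: multiset.map_comp o_def)
  also have "sort xs = rev xs"
    using assms(2) by (intro properties_for_sort) (auto simp: sorted_wrt_rev)
  finally show ?thesis by simp
qed

lemma sorted_eigs_desc: "sorted_wrt (\<ge>) (eigs_desc A)"
  unfolding eigs_desc_def by (simp add: sorted_wrt_rev)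

lemma char_poly_unitary_conj:
  assumes "A \<in> carrier_mat n n" "unitary_mat n U"
  shows "char_poly (mat_adjoint U * A * U) = char_poly A"
proof (rule char_poly_similar, rule similar_matI[of _ _ "mat_adjoint U" U n])
  show "{mat_adjoint U * A * U, A, mat_adjoint U, U} \<subseteq> carrier_mat n n"
    using assms by (auto simp: unitary_mat_def intro!: mult_carrier_mat[of _ n n _ n])
qed (use assms in \<open>auto simp: unitary_mat_def\<close>)

text \<open>Permits reordering the roots, so that a factorization found in any convenient order can
  be restated for the sorted list.\<close>

lemma linear_factors_cong_mset:
  fixes xs ys :: "real list"
  assumes "mset xs = mset ys"
  shows "(\<Prod>a\<leftarrow>map complex_of_real xs. [:- a, 1:]) = (\<Prod>a\<leftarrow>map complex_of_real ys. [:- a, 1:])"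
  by (simp only: prod_mset_prod_list[symmetric] mset_map assms)

text \<open>Diagonalization is run twice. With roots in arbitrary order it shows that they are real,
  because the diagonal of a Hermitian matrix is real. Then \<open>eigs_desc A\<close> is a
  permutation of all roots, and the second run uses it as the list of factors to obtain an
  eigenbasis in non-increasing order.\<close>

lemma hermitian_spectral:
  fixes A :: "complex mat"
  assumes A: "A \<in> carrier_mat n n" and herm: "mat_adjoint A = A"
  shows "length (eigs_desc A) = n"
    and "\<exists>U. unitary_mat n U \<and>
      mat_adjoint U * A * U = mat_diag n (\<lambda>i. complex_of_real (eigs_desc A ! i))"
proof -
  from char_poly_factorized[OF A] obtain as where
    as: "char_poly A = (\<Prod>a\<leftarrow>as. [:- a, 1:])" and len: "length as = n" by auto
  from hermitian_unitary_diagonalization[OF A herm as] obtain U where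
    U: "unitary_mat n U" and D: "mat_adjoint U * A * U = mat_diag n (\<lambda>i. as ! i)" by auto
  have Uc: "U \<in> carrier_mat n n" using U by (rule unitary_mat_carrier)
  have "mat_adjoint (mat_adjoint U * A * U) = mat_adjoint U * A * U"
    by (rule hermitian_conjugation[OF A Uc herm])
  hence eq: "mat_adjoint (mat_diag n (\<lambda>i. as ! i)) = mat_diag n (\<lambda>i. as ! i)" by (simp only: D)
  have "cnj (as ! i) = as ! i" if "i < n" for i
    using arg_cong[OF eq, of "\<lambda>M. M $$ (i, i)"] that by simp
  hence real: "a = complex_of_real (Re a)" if "a \<in> set as" for a
    using that len by (metis in_set_conv_nth Reals_cnj_iff of_real_Re)
  hence "as = map complex_of_real (map Re as)" by (auto simp: o_def intro!: nth_equalityI)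
  hence cp: "char_poly A = (\<Prod>a\<leftarrow>map complex_of_real (map Re as). [:- a, 1:])" using as by simp
  from eigs_desc_mset[OF this] have ms: "mset (eigs_desc A) = mset (map Re as)" .
  show "length (eigs_desc A) = n" using len mset_eq_length[OF ms] by simp
  have "char_poly A = (\<Prod>a\<leftarrow>map complex_of_real (eigs_desc A). [:- a, 1:])"
    unfolding cp by (rule linear_factors_cong_mset[OF ms[symmetric]])
  from hermitian_unitary_diagonalization[OF A herm this] obtain V where V: "unitary_mat n V"
    "mat_adjoint V * A * V = mat_diag n (\<lambda>i. map complex_of_real (eigs_desc A) ! i)" by auto
  note V(2)
  also have "mat_diag n (\<lambda>i. map complex_of_real (eigs_desc A) ! i)
      = mat_diag n (\<lambda>i. complex_of_real (eigs_desc A ! i))"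
    using \<open>length (eigs_desc A) = n\<close> by (intro eq_matI) auto
  finally show "\<exists>U. unitary_mat n U \<and>
      mat_adjoint U * A * U = mat_diag n (\<lambda>i. complex_of_real (eigs_desc A ! i))"
    using V(1) by blast
qed

section \<open>Spectra of Kronecker products\<close>

lemma kron_carrier[simp]:
  "A \<in> carrier_mat n n \<Longrightarrow> B \<in> carrier_mat m m \<Longrightarrow> kron A B \<in> carrier_mat (n * m) (n * m)"
  by (simp add: kron_def)

lemma div_less_of_less_mult: "i < n * (m::nat) \<Longrightarrow> i div m < n"
  by (simp add: less_mult_imp_div_less)

lemma mod_less_of_less_mult: "i < n * (m::nat) \<Longrightarrow> i mod m < m"
  by (cases "m = 0") auto

lemma kron_index:
  assumes "A \<in> carrier_mat n n" "B \<in> carrier_mat m m" "i < n * m" "j < n * m"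
  shows "kron A B $$ (i, j) = A $$ (i div m, j div m) * B $$ (i mod m, j mod m)"
  using assms by (simp add: kron_def)

text \<open>Division with remainder identifies \<open>{..<n * m}\<close> with pairs. It serves both
  for the index arithmetic of \<open>kron\<close> and for cutting spectra into blocks of length
  \<open>m\<close>.\<close>

lemma sum_div_mod:
  fixes f :: "nat \<Rightarrow> nat \<Rightarrow> 'a :: comm_monoid_add"
  shows "(\<Sum>l<n * m. f (l div m) (l mod m)) = (\<Sum>i<n. \<Sum>j<m. f i j)"
proof -
  have "(\<Sum>j = i * m..<i * m + m. f (j div m) (j mod m)) = (\<Sum>j<m. f i j)" for i
  proof -
    have "(\<Sum>j = i * m..<i * m + m. f (j div m) (j mod m))
        = (\<Sum>j = 0..<m. f ((j + i * m) div m) ((j + i * m) mod m))"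
      using sum.shift_bounds_nat_ivl[of "\<lambda>j. f (j div m) (j mod m)" 0 "i * m" m] by (simp add: add.commute)
    also have "\<dots> = (\<Sum>j<m. f i j)" by (intro sum.cong) auto
    finally show ?thesis .
  qed
  thus ?thesis by (simp add: sum.nat_group[symmetric])
qed

lemma kron_mult:
  fixes A B C D :: "complex mat"
  assumes A: "A \<in> carrier_mat n n" and B: "B \<in> carrier_mat n n"
    and C: "C \<in> carrier_mat m m" and D: "D \<in> carrier_mat m m"
  shows "kron A C * kron B D = kron (A * B) (C * D)"
proof (rule eq_matI)
  have AB: "A * B \<in> carrier_mat n n" "C * D \<in> carrier_mat m m"
    using A B C D by (auto intro: mult_carrier_mat)
  note c1 = kron_carrier[OF A C] and c2 = kron_carrier[OF B D] and c3 = kron_carrier[OF AB]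
  show "dim_row (kron A C * kron B D) = dim_row (kron (A * B) (C * D))"
    "dim_col (kron A C * kron B D) = dim_col (kron (A * B) (C * D))"
    using c1 c2 c3 by auto
  fix i j assume "i < dim_row (kron (A * B) (C * D))" "j < dim_col (kron (A * B) (C * D))"
  hence i: "i < n * m" and j: "j < n * m" using c3 by auto
  note d = div_less_of_less_mult[OF i] mod_less_of_less_mult[OF i]
     div_less_of_less_mult[OF j] mod_less_of_less_mult[OF j]
  have "(kron A C * kron B D) $$ (i, j) = (\<Sum>l<n * m.
      A $$ (i div m, l div m) * C $$ (i mod m, l mod m) * (B $$ (l div m, j div m) * D $$ (l mod m, j mod m)))"
    unfolding mult_mat_entry[OF c1 c2 i j]
    by (intro sum.cong refl) (simp add: kron_index[OF A C] kron_index[OF B D] i j)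
  also have "\<dots> = (\<Sum>k<n. \<Sum>l<m. A $$ (i div m, k) * C $$ (i mod m, l) * (B $$ (k, j div m) * D $$ (l, j mod m)))"
    by (rule sum_div_mod)
  also have "\<dots> = kron (A * B) (C * D) $$ (i, j)"
    unfolding kron_index[OF AB i j] mult_mat_entry[OF A B d(1,3)] mult_mat_entry[OF C D d(2,4)]
    by (simp add: sum_product mult_ac)
  finally show "(kron A C * kron B D) $$ (i, j) = kron (A * B) (C * D) $$ (i, j)" .
qed

lemma kron_mat_diag:
  "kron (mat_diag n f) (mat_diag m g) = mat_diag (n * m) (\<lambda>i. f (i div m) * g (i mod m))"
proof (rule eq_matI)
  fix i j assume "i < dim_row (mat_diag (n * m) (\<lambda>i. f (i div m) * g (i mod m)))"
    "j < dim_col (mat_diag (n * m) (\<lambda>i. f (i div m) * g (i mod m)))"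
  hence i: "i < n * m" and j: "j < n * m" by auto
  have "i div m = j div m \<and> i mod m = j mod m \<longleftrightarrow> i = j" by (metis div_mult_mod_eq)
  thus "kron (mat_diag n f) (mat_diag m g) $$ (i, j)
      = mat_diag (n * m) (\<lambda>i. f (i div m) * g (i mod m)) $$ (i, j)"
    using i j by (auto simp: kron_index[of _ n _ m] div_less_of_less_mult mod_less_of_less_mult)
qed (auto simp: kron_def)

lemma kron_adjoint:
  fixes A B :: "complex mat"
  assumes A: "A \<in> carrier_mat n n" and B: "B \<in> carrier_mat m m"
  shows "mat_adjoint (kron A B) = kron (mat_adjoint A) (mat_adjoint B)"
proof (rule eq_matI)
  note aA = adjoint_carrier[OF A] and aB = adjoint_carrier[OF B]
  note c1 = kron_carrier[OF A B] and c2 = kron_carrier[OF aA aB]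
  show "dim_row (mat_adjoint (kron A B)) = dim_row (kron (mat_adjoint A) (mat_adjoint B))"
    "dim_col (mat_adjoint (kron A B)) = dim_col (kron (mat_adjoint A) (mat_adjoint B))"
    using c1 c2 by simp_all
  fix i j assume "i < dim_row (kron (mat_adjoint A) (mat_adjoint B))"
    "j < dim_col (kron (mat_adjoint A) (mat_adjoint B))"
  hence i: "i < n * m" and j: "j < n * m" using c2 by auto
  show "mat_adjoint (kron A B) $$ (i, j) = kron (mat_adjoint A) (mat_adjoint B) $$ (i, j)"
    using A B carrier_matD[OF c1] i j div_less_of_less_mult[OF i] mod_less_of_less_mult[OF i]
      div_less_of_less_mult[OF j] mod_less_of_less_mult[OF j]
    by (simp add: kron_index[OF aA aB i j] kron_index[OF A B j i])
qed

lemma kron_one: "kron (1\<^sub>m n) (1\<^sub>m m) = (1\<^sub>m (n * m) :: complex mat)"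
  using kron_mat_diag[of n "\<lambda>_. 1" m "\<lambda>_. 1"] by simp

text \<open>Conjugation by the unitary \<open>kron U (1\<^sub>m m)\<close> diagonalizes the first
  factor and fixes the second, which is already diagonal for the maximally mixed state and for the
  projection alike.\<close>

lemma char_poly_kron_mat_diag:
  fixes A :: "complex mat"
  assumes A: "A \<in> carrier_mat n n" and herm: "mat_adjoint A = A"
  shows "char_poly (kron A (mat_diag m (\<lambda>i. complex_of_real (g i))))
    = (\<Prod>a\<leftarrow>map complex_of_real (map (\<lambda>i. eigs_desc A ! (i div m) * g (i mod m)) [0..<n * m]). [:- a, 1:])"
proof -
  let ?G = "mat_diag m (\<lambda>i. complex_of_real (g i))"
  from hermitian_spectral(2)[OF A herm] obtain U where U: "unitary_mat n U"
    and D: "mat_adjoint U * A * U = mat_diag n (\<lambda>i. complex_of_real (eigs_desc A ! i))" by auto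
  have Uc: "U \<in> carrier_mat n n" using U by (rule unitary_mat_carrier)
  have a1: "mat_adjoint (1\<^sub>m m) = (1\<^sub>m m :: complex mat)" by (rule eq_matI) auto
  let ?K = "kron U (1\<^sub>m m)"
  have aK: "mat_adjoint ?K = kron (mat_adjoint U) (1\<^sub>m m)" by (simp only: kron_adjoint[OF Uc one_carrier_mat] a1)
  have K: "unitary_mat (n * m) ?K"
    by (rule unitary_matI)
       (use U Uc in \<open>simp_all add: aK kron_mult[of _ n _ _ m] unitary_mat_def kron_one\<close>)
  have "mat_adjoint ?K * kron A ?G * ?K = kron (mat_adjoint U * A * U) ?G"
    using A Uc by (simp add: aK kron_mult[of _ n _ _ m] mult_carrier_mat[of _ n n _ n])
  also have "\<dots> = mat_diag (n * m) (\<lambda>i. complex_of_real (eigs_desc A ! (i div m) * g (i mod m)))"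
    by (simp add: D kron_mat_diag)
  finally show ?thesis
    using char_poly_unitary_conj[OF kron_carrier[OF A mat_diag_dim] K, of "\<lambda>i. complex_of_real (g i)"]
    by (simp only: char_poly_mat_diag map_map o_def)
qed

lemma sorted_wrt_ge_nth: "sorted_wrt (\<ge>) (xs :: real list) \<Longrightarrow> i \<le> j \<Longrightarrow> j < length xs \<Longrightarrow> xs ! j \<le> xs ! i"
  by (cases "i = j") (auto simp: sorted_wrt_iff_nth_less)

text \<open>Each eigenvalue is repeated \<open>m\<close> times with weight \<open>1 / m\<close>. As
  \<open>i div m\<close> is monotone in \<open>i\<close>, the list in index order is already
  sorted.\<close>

lemma eigs_desc_kron_maximally_mixed:
  fixes A :: "complex mat"
  assumes A: "A \<in> carrier_mat n n" and herm: "mat_adjoint A = A"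
  shows "eigs_desc (kron A ((1 / of_nat m) \<cdot>\<^sub>m 1\<^sub>m m))
    = map (\<lambda>i. eigs_desc A ! (i div m) / real m) [0..<n * m]"
proof (rule eigs_desc_eqI)
  have "(1 / of_nat m) \<cdot>\<^sub>m 1\<^sub>m m = mat_diag m (\<lambda>i. complex_of_real (1 / real m))"
    by (rule eq_matI) auto
  thus "char_poly (kron A ((1 / of_nat m) \<cdot>\<^sub>m 1\<^sub>m m)) = (\<Prod>a\<leftarrow>map complex_of_real
      (map (\<lambda>i. eigs_desc A ! (i div m) / real m) [0..<n * m]). [:- a, 1:])"
    using char_poly_kron_mat_diag[OF A herm, of m "\<lambda>_. 1 / real m"] by simp
  have "length (eigs_desc A) = n" by (rule hermitian_spectral(1)[OF A herm])
  thus "sorted_wrt (\<ge>) (map (\<lambda>i. eigs_desc A ! (i div m) / real m) [0..<n * m])"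
    using sorted_eigs_desc[of A]
    by (auto simp: sorted_wrt_iff_nth_less div_le_mono div_less_of_less_mult
        intro!: divide_right_mono sorted_wrt_ge_nth)
qed

lemma ket0_proj_eq_mat_diag: "ket0_proj m = mat_diag m (\<lambda>i. complex_of_real (if i = 0 then 1 else 0))"
  by (rule eq_matI) (auto simp: ket0_proj_def)

text \<open>Each block of \<open>m\<close> indices contributes one value of \<open>f\<close>, at
  remainder 0, and \<open>m - 1\<close> zeros. This brings the spectrum of a product with
  \<open>ket0_proj m\<close> into a form with all zeros at the end.\<close>

lemma mset_spread_zeros:
  fixes f :: "nat \<Rightarrow> real"
  assumes "m > 0"
  shows "mset (map (\<lambda>i. f (i div m) * (if i mod m = 0 then 1 else 0)) [0..<n * m])
    = mset (map f [0..<n] @ replicate (n * (m - 1)) 0)"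
proof (induction n)
  case (Suc n)
  let ?g = "\<lambda>i. f (i div m) * (if i mod m = 0 then 1 else 0)"
  have "map ?g [n * m..<n * m + m] = f n # replicate (m - 1) 0"
    using assms by (intro nth_equalityI) (auto simp: nth_Cons' div_mult_self3)
  moreover have "[0..<Suc n * m] = [0..<n * m] @ [n * m..<n * m + m]"
    using upt_add_eq_append[of 0 "n * m" m] by (simp add: add.commute)
  moreover have "Suc n * (m - 1) = n * (m - 1) + (m - 1)" by simp
  ultimately show ?case using Suc by (simp add: replicate_add)
qed simp

text \<open>Nonnegativity of the spectrum puts the additional zeros behind all eigenvalues of
  \<open>A\<close> in the sorted order.\<close>

lemma eigs_desc_kron_ket0:
  fixes A :: "complex mat"
  assumes A: "A \<in> carrier_mat n n" and herm: "mat_adjoint A = A"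
    and m: "m > 0" and pos: "\<forall>x \<in> set (eigs_desc A). x \<ge> 0"
  shows "eigs_desc (kron A (ket0_proj m)) = eigs_desc A @ replicate (n * (m - 1)) 0"
proof (rule eigs_desc_eqI)
  have "length (eigs_desc A) = n" by (rule hermitian_spectral(1)[OF A herm])
  hence "map (\<lambda>i. eigs_desc A ! i) [0..<n] = eigs_desc A" by (metis map_nth)
  thus "char_poly (kron A (ket0_proj m)) =
      (\<Prod>a\<leftarrow>map complex_of_real (eigs_desc A @ replicate (n * (m - 1)) 0). [:- a, 1:])"
    unfolding ket0_proj_eq_mat_diag char_poly_kron_mat_diag[OF A herm]
    by (intro linear_factors_cong_mset) (simp only: mset_spread_zeros[OF m])
  show "sorted_wrt (\<ge>) (eigs_desc A @ replicate (n * (m - 1)) 0)"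
    using pos sorted_eigs_desc[of A] by (auto simp: sorted_wrt_append sorted_wrt_iff_nth_less[of _ "replicate _ _"])
qed

section \<open>Ky Fan's principle and the trace distance\<close>

lemma mtrace_mat_diag: "mtrace (mat_diag n f) = (\<Sum>i<n. f i)"
  by (simp add: mtrace_def)

lemma mtrace_mult_comm:
  assumes "A \<in> carrier_mat n n" "B \<in> carrier_mat n n"
  shows "mtrace (A * B) = mtrace (B * A)"
proof -
  have "mtrace (A * B) = (\<Sum>i<n. \<Sum>l<n. A $$ (i, l) * B $$ (l, i))"
    unfolding mtrace_def using assms by (intro sum.cong) (auto simp: mult_mat_entry[of _ n n _ n] simp del: index_mult_mat(1))
  also have "\<dots> = (\<Sum>l<n. \<Sum>i<n. B $$ (l, i) * A $$ (i, l))"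
    by (subst sum.swap) (simp add: mult.commute)
  also have "\<dots> = mtrace (B * A)"
    unfolding mtrace_def using assms by (intro sum.cong) (auto simp: mult_mat_entry[of _ n n _ n] simp del: index_mult_mat(1))
  finally show ?thesis .
qed

lemma mtrace_minus:
  assumes "A \<in> carrier_mat n n" "B \<in> carrier_mat n n"
  shows "mtrace (A - B) = mtrace A - mtrace B"
  using assms by (simp add: mtrace_def sum_subtractf)

lemma mtrace_unitary_conj:
  assumes A: "A \<in> carrier_mat n n" and U: "unitary_mat n U"
  shows "mtrace (mat_adjoint U * A * U) = mtrace A"
proof -
  have Uc: "U \<in> carrier_mat n n" using U by (rule unitary_mat_carrier)
  note aU = adjoint_carrier[OF Uc]
  have "mtrace (mat_adjoint U * A * U) = mtrace (U * (mat_adjoint U * A))"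
    by (rule mtrace_mult_comm[OF mult_carrier_mat[OF aU A] Uc])
  also have "U * (mat_adjoint U * A) = U * mat_adjoint U * A"
    by (rule assoc_mult_mat[OF Uc aU A, symmetric])
  also have "\<dots> = A" using U A by (simp add: unitary_mat_def)
  finally show ?thesis .
qed

lemma sum_eigs_desc:
  fixes A :: "complex mat"
  assumes A: "A \<in> carrier_mat n n" and herm: "mat_adjoint A = A"
  shows "(\<Sum>i<n. eigs_desc A ! i) = Re (mtrace A)"
proof -
  from hermitian_spectral(2)[OF A herm] obtain U where U: "unitary_mat n U"
    and D: "mat_adjoint U * A * U = mat_diag n (\<lambda>i. complex_of_real (eigs_desc A ! i))" by auto
  have "mtrace A = complex_of_real (\<Sum>i<n. eigs_desc A ! i)"
    using mtrace_unitary_conj[OF A U] by (simp add: D mtrace_mat_diag)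
  thus ?thesis by (simp only: Re_complex_of_real)
qed

text \<open>The trace of the compression of \<open>A\<close> to the span of the first
  \<open>k\<close> columns of \<open>U\<close>: the quantity maximized in Ky Fan's
  principle.\<close>

definition compressed_trace :: "nat \<Rightarrow> complex mat \<Rightarrow> complex mat \<Rightarrow> real" where
  "compressed_trace k U A = Re (\<Sum>i<k. (mat_adjoint U * A * U) $$ (i, i))"

lemma compressed_trace_minus:
  assumes A: "A \<in> carrier_mat n n" and B: "B \<in> carrier_mat n n" and U: "U \<in> carrier_mat n n" and k: "k \<le> n"
  shows "compressed_trace k U (A - B) = compressed_trace k U A - compressed_trace k U B"
proof -
  note aU = adjoint_carrier[OF U]
  have eq: "mat_adjoint U * (A - B) * U = mat_adjoint U * A * U - mat_adjoint U * B * U"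
    unfolding mult_minus_distrib_mat[OF aU A B]
    by (rule minus_mult_distrib_mat[OF mult_carrier_mat[OF aU A] mult_carrier_mat[OF aU B] U])
  have "mat_adjoint U * X * U \<in> carrier_mat n n" if "X \<in> carrier_mat n n" for X
    using mult_carrier_mat[OF mult_carrier_mat[OF aU that] U] .
  note c = carrier_matD[OF this[OF A]] carrier_matD[OF this[OF B]]
  show ?thesis
    using k c by (simp add: compressed_trace_def eq sum_subtractf del: index_mult_mat(1))
qed

text \<open>With \<open>V\<close> an eigenbasis of \<open>A\<close> and \<open>W\<close> the change
  of basis from \<open>U\<close> to \<open>V\<close>, the weight \<open>c j\<close> is the sum of
  the squared moduli of the first \<open>k\<close> entries in row \<open>j\<close> of
  \<open>W\<close>. The squared moduli form a doubly stochastic matrix: row sums bound each weight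
  by 1, column sums give the total \<open>k\<close>. Both estimates of the compressed trace below
  reduce to this representation.\<close>

lemma compressed_trace_weights:
  assumes A: "A \<in> carrier_mat n n" and herm: "mat_adjoint A = A" and U: "unitary_mat n U" and k: "k \<le> n"
  obtains c where "\<And>j. j < n \<Longrightarrow> 0 \<le> c j" "\<And>j. j < n \<Longrightarrow> c j \<le> 1" "(\<Sum>j<n. c j) = real k"
    "compressed_trace k U A = (\<Sum>j<n. eigs_desc A ! j * c j)"
proof -
  let ?t = "\<lambda>i. eigs_desc A ! i"
  from hermitian_spectral(2)[OF A herm] obtain V where V: "unitary_mat n V"
    and D: "mat_adjoint V * A * V = mat_diag n (\<lambda>i. complex_of_real (?t i))" by auto
  define W where "W = mat_adjoint V * U"
  have W: "unitary_mat n W" unfolding W_def by (intro unitary_mat_mult unitary_mat_adjoint V U)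
  have Uc: "U \<in> carrier_mat n n" and Vc: "V \<in> carrier_mat n n" and Wc: "W \<in> carrier_mat n n"
    using U V W by (simp_all add: unitary_mat_def)
  note aV = adjoint_carrier[OF Vc] and aW = adjoint_carrier[OF Wc]
  have "V * W = V * mat_adjoint V * U"
    unfolding W_def by (rule assoc_mult_mat[OF Vc aV Uc, symmetric])
  hence "U = V * W" using V Uc by (simp add: unitary_mat_def)
  hence conj: "mat_adjoint U * A * U = mat_adjoint W * mat_diag n (\<lambda>i. complex_of_real (?t i)) * W"
    using conjugation_mult[OF A Vc Wc] by (simp only: D)
  have entry: "(mat_adjoint U * A * U) $$ (i, i) = complex_of_real (\<Sum>j<n. ?t j * (cmod (W $$ (j, i)))\<^sup>2)"
    if i: "i < n" for i
  proof -
    have "(mat_adjoint U * A * U) $$ (i, i)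
      = (\<Sum>j<n. cnj (W $$ (j, i)) * complex_of_real (?t j) * W $$ (j, i))"
      unfolding conj mat_diag_mult_right[OF aW] using Wc i
      by (subst mult_mat_entry[of _ n n _ n]) auto
    also have "\<dots> = (\<Sum>j<n. complex_of_real (?t j * (cmod (W $$ (j, i)))\<^sup>2))"
      by (intro sum.cong refl) (simp only: of_real_mult complex_norm_square mult_ac)
    finally show ?thesis by simp
  qed
  have row: "(\<Sum>i<n. (cmod (W $$ (j, i)))\<^sup>2) = 1" if j: "j < n" for j
  proof -
    have "complex_of_real (\<Sum>i<n. (cmod (W $$ (j, i)))\<^sup>2) = (W * mat_adjoint W) $$ (j, j)"
      using Wc j unfolding mult_mat_entry[OF Wc aW j j] of_real_sum
      by (intro sum.cong refl) (simp only: complex_norm_square, simp)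
    also have "\<dots> = 1" using W j by (simp add: unitary_mat_def)
    finally show ?thesis by (simp only: of_real_eq_1_iff)
  qed
  have col: "(\<Sum>j<n. (cmod (W $$ (j, i)))\<^sup>2) = 1" if i: "i < n" for i
  proof -
    have "complex_of_real (\<Sum>j<n. (cmod (W $$ (j, i)))\<^sup>2) = (mat_adjoint W * W) $$ (i, i)"
      using Wc i unfolding mult_mat_entry[OF aW Wc i i] of_real_sum
      by (intro sum.cong refl) (simp only: complex_norm_square, simp)
    also have "\<dots> = 1" using W i by (simp add: unitary_mat_def)
    finally show ?thesis by (simp only: of_real_eq_1_iff)
  qed
  let ?c = "\<lambda>j. \<Sum>i<k. (cmod (W $$ (j, i)))\<^sup>2"
  show ?thesis
  proof (rule that[of ?c])
    show "0 \<le> ?c j" for j by (simp add: sum_nonneg)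
    show "?c j \<le> 1" if "j < n" for j
      using sum_mono2[of "{..<n}" "{..<k}" "\<lambda>i. (cmod (W $$ (j, i)))\<^sup>2"] row[OF that] k by auto
    show "(\<Sum>j<n. ?c j) = real k"
      by (subst sum.swap) (use k col in simp)
    have "compressed_trace k U A = (\<Sum>i<k. \<Sum>j<n. ?t j * (cmod (W $$ (j, i)))\<^sup>2)"
      unfolding compressed_trace_def Re_sum using k entry by (intro sum.cong refl) simp
    also have "\<dots> = (\<Sum>j<n. ?t j * ?c j)" by (subst sum.swap) (simp add: sum_distrib_left)
    finally show "compressed_trace k U A = (\<Sum>j<n. ?t j * ?c j)" .
  qed
qed

text \<open>Compare \<open>c\<close> with the indicator of the first \<open>k\<close> indices, using
  \<open>x (k - 1)\<close> as threshold: \<open>x j - x (k - 1)\<close> and \<open>c j\<close> minus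
  the indicator never have the same strict sign. The threshold drops out on summation because both
  weightings have total \<open>k\<close>.\<close>

lemma weighted_sum_le_top_sum:
  fixes x :: "nat \<Rightarrow> real"
  assumes anti: "\<And>i j. i \<le> j \<Longrightarrow> j < n \<Longrightarrow> x j \<le> x i"
    and c: "\<And>j. j < n \<Longrightarrow> 0 \<le> c j" "\<And>j. j < n \<Longrightarrow> c j \<le> 1" "(\<Sum>j<n. c j) = real k"
    and k: "0 < k" "k \<le> n"
  shows "(\<Sum>j<n. x j * c j) \<le> (\<Sum>j<k. x j)"
proof -
  let ?b = "\<lambda>j. if j < k then 1 else 0 :: real"
  have sub: "{..<n} \<inter> {j. j < k} = {..<k}" using k by auto
  have "(x j - x (k - 1)) * (c j - ?b j) \<le> 0" if "j < n" for j
    using anti[of j "k - 1"] anti[of "k - 1" j] c(1,2)[OF that] that k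
    by (auto simp: mult_le_0_iff)
  hence "(\<Sum>j<n. (x j - x (k - 1)) * (c j - ?b j)) \<le> 0" by (intro sum_nonpos) auto
  also have "(\<Sum>j<n. (x j - x (k - 1)) * (c j - ?b j))
      = (\<Sum>j<n. x j * c j) - (\<Sum>j<n. x j * ?b j) - x (k - 1) * ((\<Sum>j<n. c j) - (\<Sum>j<n. ?b j))"
    by (simp add: left_diff_distrib right_diff_distrib sum_subtractf sum_distrib_left)
  also have "(\<Sum>j<n. x j * ?b j) = (\<Sum>j<k. x j)"
    by (simp add: if_distrib[of "\<lambda>y. _ * y"] sum.If_cases sub)
  also have "(\<Sum>j<n. ?b j) = real k" by (simp add: sum.If_cases sub)
  finally show ?thesis using c(3) by simp
qed

lemma compressed_trace_le_top_eigs: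
  assumes A: "A \<in> carrier_mat n n" and herm: "mat_adjoint A = A" and U: "unitary_mat n U"
    and k: "0 < k" "k \<le> n"
  shows "compressed_trace k U A \<le> (\<Sum>j<k. eigs_desc A ! j)"
proof -
  from compressed_trace_weights[OF A herm U k(2)] obtain c where
    c: "\<And>j. j < n \<Longrightarrow> 0 \<le> c j" "\<And>j. j < n \<Longrightarrow> c j \<le> 1" "(\<Sum>j<n. c j) = real k"
    "compressed_trace k U A = (\<Sum>j<n. eigs_desc A ! j * c j)" by blast
  show ?thesis unfolding c(4)
    by (rule weighted_sum_le_top_sum[OF _ c(1-3) k])
       (auto intro: sorted_wrt_ge_nth[OF sorted_eigs_desc] simp: hermitian_spectral(1)[OF A herm])
qed

text \<open>A weight in [0, 1] takes at most the positive part
  \<open>(\<bar>t\<bar> + t) / 2\<close> of an eigenvalue \<open>t\<close>. For a traceless matrix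
  the positive parts add up to half the trace norm.\<close>

lemma compressed_trace_le_half_trace_norm:
  assumes A: "A \<in> carrier_mat n n" and herm: "mat_adjoint A = A" and tr: "mtrace A = 0"
    and U: "unitary_mat n U" and k: "k \<le> n"
  shows "compressed_trace k U A \<le> trace_norm_herm A / 2"
proof -
  let ?t = "\<lambda>j. eigs_desc A ! j"
  from compressed_trace_weights[OF A herm U k] obtain c where
    c: "\<And>j. j < n \<Longrightarrow> 0 \<le> c j" "\<And>j. j < n \<Longrightarrow> c j \<le> 1" "(\<Sum>j<n. c j) = real k"
    "compressed_trace k U A = (\<Sum>j<n. ?t j * c j)" by blast
  have "?t j * c j \<le> (\<bar>?t j\<bar> + ?t j) / 2" if "j < n" for j
    using mult_left_le[OF c(2)[OF that], of "?t j"] mult_nonpos_nonneg[OF _ c(1)[OF that], of "?t j"]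
    by (cases "?t j \<ge> 0") simp_all
  hence "compressed_trace k U A \<le> (\<Sum>j<n. (\<bar>?t j\<bar> + ?t j) / 2)"
    unfolding c(4) by (intro sum_mono) auto
  also have "\<dots> = ((\<Sum>j<n. \<bar>?t j\<bar>) + (\<Sum>j<n. ?t j)) / 2"
    by (simp add: sum.distrib flip: sum_divide_distrib)
  also have "(\<Sum>j<n. ?t j) = 0" by (simp add: sum_eigs_desc[OF A herm] tr)
  also have "(\<Sum>j<n. \<bar>?t j\<bar>) = trace_norm_herm A"
    by (simp add: trace_norm_herm_def sum_list_sum_nth hermitian_spectral(1)[OF A herm] atLeast0LessThan)
  finally show ?thesis by simp
qed

lemma top_eigs_diff_le_trace_dist:
  assumes A: "density_mat n A" and B: "density_mat n B" and k: "0 < k" "k \<le> n"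
  shows "(\<Sum>j<k. eigs_desc A ! j) \<le> (\<Sum>j<k. eigs_desc B ! j) + trace_dist A B"
proof -
  have Ac: "A \<in> carrier_mat n n" and Ah: "mat_adjoint A = A" and Bc: "B \<in> carrier_mat n n"
    and Bh: "mat_adjoint B = B" and tr: "mtrace A = 1" "mtrace B = 1"
    using A B by (simp_all add: density_mat_def)
  have ABc: "A - B \<in> carrier_mat n n" using Bc by (rule minus_carrier_mat)
  have ABh: "mat_adjoint (A - B) = A - B" by (simp add: adjoint_minus[OF Ac Bc] Ah Bh)
  have ABt: "mtrace (A - B) = 0" by (simp add: mtrace_minus[OF Ac Bc] tr)
  from hermitian_spectral(2)[OF Ac Ah] obtain U where U: "unitary_mat n U"
    and D: "mat_adjoint U * A * U = mat_diag n (\<lambda>i. complex_of_real (eigs_desc A ! i))" by auto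
  \<comment> \<open>The sorted eigenbasis of \<open>A\<close> makes the compression exact for
    \<open>A\<close>; for \<open>B\<close> and \<open>A - B\<close> the same \<open>U\<close> is an
    arbitrary unitary, and upper bounds suffice.\<close>
  have "(\<Sum>j<k. eigs_desc A ! j) = compressed_trace k U A"
    unfolding compressed_trace_def D using k by simp
  also have "\<dots> = compressed_trace k U B + compressed_trace k U (A - B)"
    by (simp add: compressed_trace_minus[OF Ac Bc unitary_mat_carrier[OF U] k(2)])
  also have "\<dots> \<le> (\<Sum>j<k. eigs_desc B ! j) + trace_dist A B"
    unfolding trace_dist_def
    by (intro add_mono compressed_trace_le_top_eigs[OF Bc Bh U k]
        compressed_trace_le_half_trace_norm[OF ABc ABh ABt U k(2)])
  finally show ?thesis .
qed

text \<open>Each eigenvalue is the value of the quadratic form of \<open>A\<close> at the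
  corresponding column of a diagonalizing unitary.\<close>

lemma density_mat_eigs_nonneg:
  assumes "density_mat n A"
  shows "\<forall>x \<in> set (eigs_desc A). 0 \<le> x"
proof
  have A: "A \<in> carrier_mat n n" and herm: "mat_adjoint A = A"
    and pos: "\<And>v. v \<in> carrier_vec n \<Longrightarrow> 0 \<le> Re (conjugate v \<bullet> (A *\<^sub>v v))"
    using assms by (auto simp: density_mat_def)
  from hermitian_spectral(2)[OF A herm] obtain U where U: "unitary_mat n U"
    and D: "mat_adjoint U * A * U = mat_diag n (\<lambda>i. complex_of_real (eigs_desc A ! i))" by auto
  have Uc: "U \<in> carrier_mat n n" using U by (rule unitary_mat_carrier)
  note aU = adjoint_carrier[OF Uc]
  fix x assume "x \<in> set (eigs_desc A)"
  then obtain i where i: "i < n" and x: "x = eigs_desc A ! i"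
    using hermitian_spectral(1)[OF A herm] by (metis in_set_conv_nth)
  have v: "col U i \<in> carrier_vec n" using Uc by auto
  have row: "row (mat_adjoint U) i = conjugate (col U i)"
    using Uc i by (intro eq_vecI) auto
  have "complex_of_real x = (mat_adjoint U * A * U) $$ (i, i)" using i by (simp add: D x)
  also have "\<dots> = (mat_adjoint U * (A * U)) $$ (i, i)" by (simp only: assoc_mult_mat[OF aU A Uc])
  also have "\<dots> = row (mat_adjoint U) i \<bullet> col (A * U) i"
    using Uc A i by (subst index_mult_mat) auto
  also have "col (A * U) i = A *\<^sub>v col U i" using i by (rule col_mult2[OF A Uc])
  finally show "0 \<le> x" using pos[OF v] by (metis row Re_complex_of_real)
qed

section \<open>The lower bound on the trace distance\<close>

lemma trace_dist_lower_bound: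
  assumes m: "m \<ge> 2" and n: "n = m ^ a"
    and A: "density_mat n A" and B: "density_mat n B"
    and maj: "majorizes (kron A ((1 / of_nat m) \<cdot>\<^sub>m 1\<^sub>m m)) (kron B (ket0_proj m))"
  shows "(real m - 1) / (1 + (real m - 1) * real a) \<le> trace_dist A B"
proof -
  define P where "P k = (\<Sum>i<k. eigs_desc A ! i)" for k
  define Q where "Q k = (\<Sum>i<k. eigs_desc B ! i)" for k
  let ?d = "trace_dist A B"
  have Ac: "A \<in> carrier_mat n n" and Ah: "mat_adjoint A = A" and Bc: "B \<in> carrier_mat n n"
    and Bh: "mat_adjoint B = B" and tr: "mtrace B = 1"
    using A B by (simp_all add: density_mat_def)
  have m0: "m > 0" and n0: "n > 0" using m n by auto
  have lenB: "length (eigs_desc B) = n" by (rule hermitian_spectral(1)[OF Bc Bh])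
  \<comment> \<open>For \<open>k \<le> n\<close> neither list is read beyond its end, and on the
    right the zeros coming from the projection are not reached, so only genuine eigenvalues of
    \<open>B\<close> occur.\<close>
  have maj': "(\<Sum>i<k. eigs_desc B ! i) \<le> (\<Sum>i<k. eigs_desc A ! (i div m) / real m)" if k: "k \<le> n" for k
  proof -
    have km: "k \<le> n * m" using k m0 by (simp add: order_trans)
    let ?LA = "map (\<lambda>i. eigs_desc A ! (i div m) / real m) [0..<n * m]"
    let ?LB = "eigs_desc B @ replicate (n * (m - 1)) 0"
    have "(\<Sum>i<k. eigs_desc B ! i) = (\<Sum>i<k. pad_nth ?LB i)"
      using k lenB by (intro sum.cong) (auto simp: pad_nth_def nth_append)
    also have "\<dots> \<le> (\<Sum>i<k. pad_nth ?LA i)"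
      using maj unfolding majorizes_def eigs_desc_kron_maximally_mixed[OF Ac Ah]
        eigs_desc_kron_ket0[OF Bc Bh m0 density_mat_eigs_nonneg[OF B]] by blast
    also have "\<dots> = (\<Sum>i<k. eigs_desc A ! (i div m) / real m)"
      using km by (intro sum.cong) (auto simp: pad_nth_def)
    finally show ?thesis .
  qed
  have step: "Q (k * m) \<le> P k" if "k * m \<le> n" for k
  proof -
    have "Q (k * m) \<le> (\<Sum>i<k * m. eigs_desc A ! (i div m) / real m)"
      unfolding Q_def by (rule maj'[OF that])
    also have "\<dots> = P k"
      unfolding P_def using m0 sum_div_mod[of "\<lambda>i j. eigs_desc A ! i / real m" m k] by simp
    finally show ?thesis .
  qed
  have PQ: "P k \<le> Q k + ?d" if "0 < k" "k \<le> n" for k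
    unfolding P_def Q_def by (rule top_eigs_diff_le_trace_dist[OF A B that])
  \<comment> \<open>The partial sum of length 1 sees just one of the \<open>m\<close> equal parts of
    the top eigenvalue of \<open>A\<close>; this gains the factor \<open>m\<close> over the
    estimates by full blocks.\<close>
  have first: "real m * Q 1 \<le> P 1"
    using maj'[of 1] n0 m0 by (simp add: P_def Q_def field_simps)
  have "Q (m ^ j) \<le> Q 1 + real j * ?d" if "j \<le> a" for j
    using that
  proof (induction j)
    case (Suc j)
    have le: "m ^ j * m \<le> n" using power_increasing[OF Suc.prems, of m] m0 by (simp add: n mult.commute)
    have "m ^ j \<le> n" using power_increasing[of j a m] Suc.prems m0 by (simp add: n)
    hence "Q (m ^ j * m) \<le> Q (m ^ j) + ?d"
      using step[OF le] PQ[of "m ^ j"] m0 by simp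
    also have "\<dots> \<le> Q 1 + real (Suc j) * ?d" using Suc by (simp add: algebra_simps)
    finally show ?case by (simp add: mult.commute)
  qed simp
  hence "1 \<le> Q 1 + real a * ?d"
    using sum_eigs_desc[OF Bc Bh] tr by (force simp: Q_def n)
  \<comment> \<open>The multiplier is chosen so that \<open>first\<close> together with
    \<open>PQ\<close> at 1 eliminates \<open>Q 1\<close>, leaving a bound in terms of the distance
    alone.\<close>
  hence "real m - 1 \<le> (real m - 1) * (Q 1 + real a * ?d)" using m by (simp add: mult_le_cancel_left1)
  also have "\<dots> \<le> ?d + (real m - 1) * real a * ?d"
    using first PQ[of 1] n0 by (simp add: algebra_simps)
  also have "\<dots> = ?d * (1 + (real m - 1) * real a)" by (simp add: algebra_simps)
  finally show ?thesis
    using m by (subst pos_divide_le_eq) (auto intro: add_pos_nonneg)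
qed

section \<open>The extremal pair\<close>

lemma density_mat_mat_diag:
  assumes "\<And>i. i < n \<Longrightarrow> 0 \<le> f i" "(\<Sum>i<n. f i) = 1"
  shows "density_mat n (mat_diag n (\<lambda>i. complex_of_real (f i)))"
proof -
  let ?D = "mat_diag n (\<lambda>i. complex_of_real (f i))"
  have "0 \<le> Re (conjugate v \<bullet> (?D *\<^sub>v v))" if v: "v \<in> carrier_vec n" for v
  proof -
    have Dv: "?D *\<^sub>v v = vec n (\<lambda>i. complex_of_real (f i) * v $ i)"
      using v by (intro eq_vecI)
        (auto simp: scalar_prod_def if_distrib[of "\<lambda>x. x * _"] sum.delta cong: if_cong)
    have "conjugate v \<bullet> (?D *\<^sub>v v) = (\<Sum>i<n. cnj (v $ i) * (complex_of_real (f i) * v $ i))"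
      unfolding Dv scalar_prod_def using v by (simp add: atLeast0LessThan)
    also have "\<dots> = (\<Sum>i<n. complex_of_real (f i * (cmod (v $ i))\<^sup>2))"
      by (intro sum.cong refl) (simp only: of_real_mult complex_norm_square mult_ac)
    also have "Re \<dots> = (\<Sum>i<n. f i * (cmod (v $ i))\<^sup>2)"
      by (simp only: Re_sum Re_complex_of_real)
    finally show ?thesis using assms(1) by (auto intro!: sum_nonneg)
  qed
  moreover have "mat_adjoint ?D = ?D" by (rule eq_matI) auto
  moreover have "mtrace ?D = 1" unfolding mtrace_mat_diag using assms(2) by (simp flip: of_real_sum)
  ultimately show ?thesis by (simp add: density_mat_def)
qed

lemma trace_norm_mat_diag:
  "trace_norm_herm (mat_diag n (\<lambda>i. complex_of_real (f i))) = (\<Sum>i<n. \<bar>f i\<bar>)"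
proof -
  have "char_poly (mat_diag n (\<lambda>i. complex_of_real (f i)))
      = (\<Prod>a\<leftarrow>map complex_of_real (map f [0..<n]). [:- a, 1:])"
    by (simp add: char_poly_mat_diag o_def)
  note ms = eigs_desc_mset[OF this]
  have "trace_norm_herm (mat_diag n (\<lambda>i. complex_of_real (f i)))
      = sum_mset (mset (map abs (eigs_desc (mat_diag n (\<lambda>i. complex_of_real (f i))))))"
    by (simp only: trace_norm_herm_def sum_mset_sum_list)
  also have "\<dots> = sum_list (map abs (map f [0..<n]))"
    by (simp only: mset_map ms sum_mset_sum_list flip: sum_mset_sum_list)
  also have "\<dots> = (\<Sum>i<n. \<bar>f i\<bar>)" by (simp add: o_def interv_sum_list_conv_sum_set_nat atLeast0LessThan)
  finally show ?thesis .
qed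

text \<open>The two products have the same characteristic polynomial, hence the same
  \<open>eigs_desc\<close>, so majorization holds with equality in every partial sum. Vanishing of
  \<open>f (i div m)\<close> from index \<open>n\<close> on supplies exactly the
  \<open>n * (m - 1)\<close> zeros produced by the projection.\<close>

lemma majorizes_mat_diagI:
  fixes f g :: "nat \<Rightarrow> real"
  assumes m: "m > 0" and eq: "\<And>i. i < n \<Longrightarrow> f (i div m) / real m = g i"
    and zero: "\<And>i. n \<le> i \<Longrightarrow> f (i div m) = 0"
  shows "majorizes (kron (mat_diag n (\<lambda>i. complex_of_real (f i))) ((1 / of_nat m) \<cdot>\<^sub>m 1\<^sub>m m))
    (kron (mat_diag n (\<lambda>i. complex_of_real (g i))) (ket0_proj m))"
proof -
  have len: "n + n * (m - 1) = n * m" using m by (cases m) auto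
  let ?z = "\<lambda>i. g (i div m) * (if i mod m = 0 then 1 else 0)"
  have "(1 / of_nat m) \<cdot>\<^sub>m 1\<^sub>m m = mat_diag m (\<lambda>i. complex_of_real (1 / real m))"
    by (rule eq_matI) auto
  hence "char_poly (kron (mat_diag n (\<lambda>i. complex_of_real (f i))) ((1 / of_nat m) \<cdot>\<^sub>m 1\<^sub>m m))
      = (\<Prod>a\<leftarrow>map complex_of_real (map (\<lambda>i. f (i div m) / real m) [0..<n * m]). [:- a, 1:])"
    by (simp add: kron_mat_diag char_poly_mat_diag o_def)
  also have "map (\<lambda>i. f (i div m) / real m) [0..<n * m] = map g [0..<n] @ replicate (n * (m - 1)) 0"
    using len by (intro nth_equalityI) (auto simp: nth_append eq zero)
  also have "(\<Prod>a\<leftarrow>map complex_of_real (map g [0..<n] @ replicate (n * (m - 1)) 0). [:- a, 1:])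
      = (\<Prod>a\<leftarrow>map complex_of_real (map ?z [0..<n * m]). [:- a, 1:])"
    by (intro linear_factors_cong_mset mset_spread_zeros[OF m, symmetric])
  also have "\<dots> = char_poly (kron (mat_diag n (\<lambda>i. complex_of_real (g i))) (ket0_proj m))"
    unfolding ket0_proj_eq_mat_diag kron_mat_diag char_poly_mat_diag map_map o_def of_real_mult ..
  finally show ?thesis by (simp add: majorizes_def eigs_desc_def)
qed

text \<open>If \<open>m ^ j \<le> i div m < m ^ (j + 1)\<close>, then \<open>i\<close> lies in the
  next such bracket. Adding 1 turns these brackets into intervals open on the left and closed on the
  right, on which the ceiling of the logarithm is constant.\<close>

lemma ceiling_log_Suc_div:
  fixes m i :: nat
  assumes m: "m \<ge> 2" and i: "i \<ge> m"
  shows "\<lceil>log (real m) (real (i + 1))\<rceil> = \<lceil>log (real m) (real (i div m + 1))\<rceil> + 1"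
proof -
  have k0: "i div m \<ge> 1" using m i by (simp add: Suc_leI div_greater_zero_iff)
  obtain j where j: "m ^ j \<le> i div m" "i div m < m ^ (j + 1)"
    using ex_power_ivl1[OF m k0] by auto
  have lo: "m ^ j * m \<le> i" using j(1) m by (simp add: less_eq_div_iff_mult_less_eq)
  have hi: "i < m ^ (j + 1) * m" using j(2) m by (simp add: div_less_iff_less_mult)
  have "\<lceil>log (real m) (real (i div m + 1))\<rceil> = int j + 1"
    by (rule ceiling_log_nat_eq_if) (use j m in auto)
  moreover have "\<lceil>log (real m) (real (i + 1))\<rceil> = int (j + 1) + 1"
    by (rule ceiling_log_nat_eq_if) (use lo hi m in \<open>auto simp: mult_ac\<close>)
  ultimately show ?thesis by simp
qed

text \<open>The minimum is expressed as a lower bound for all admissible pairs together with an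
  admissible pair attaining it. \<open>w\<close> and \<open>wp\<close> count from 1 and matrix
  indices from 0, hence the shifts \<open>j + 1\<close>. The case \<open>i = 1\<close> of
  \<open>wp\<close> is separate because the power formula would give \<open>m * w1\<close>
  there.\<close>

theorem mainTheorem1:
  fixes m a n :: nat
  assumes "m \<ge> 2" and "a \<ge> 1" and "n = m ^ a"
  defines "w1 \<equiv> 1 / (1 + (real m - 1) * real a)"
  defines "wp \<equiv> (\<lambda>i::nat. if i = 1 then w1
                   else w1 * real m powr (1 - real_of_int \<lceil>log (real m) (real i)\<rceil>))"
  defines "w \<equiv> (\<lambda>i::nat. if i = 1 then real m * w1
                   else if i \<le> n div m then wp i else 0)"
  defines "W \<equiv> mat_diag n (\<lambda>j. complex_of_real (w (j + 1)))"
  defines "W' \<equiv> mat_diag n (\<lambda>j. complex_of_real (wp (j + 1)))"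
  shows "(\<forall>\<omega> \<omega>'. density_mat n \<omega> \<and> density_mat n \<omega>' \<and>
            majorizes (kron \<omega> ((1 / of_nat m) \<cdot>\<^sub>m 1\<^sub>m m)) (kron \<omega>' (ket0_proj m))
            \<longrightarrow> (real m - 1) / (1 + (real m - 1) * real a) \<le> trace_dist \<omega> \<omega>')
       \<and> density_mat n W \<and> density_mat n W'
       \<and> majorizes (kron W ((1 / of_nat m) \<cdot>\<^sub>m 1\<^sub>m m)) (kron W' (ket0_proj m))
       \<and> trace_dist W W' = (real m - 1) / (1 + (real m - 1) * real a)
       \<and> (real m - 1) / (1 + (real m - 1) * real a)
           = (real m - 1) / (1 + (real m - 1) * log (real m) (real n))"
proof (intro conjI allI impI)
  note m = assms(1) and a = assms(2) and n = assms(3)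
  obtain b where b: "a = Suc b" using a by (cases a) auto
  have m0: "m > 0" and nm: "n div m = m ^ b" and nb: "n = m ^ b * m" using m by (auto simp: n b)
  have mb: "m ^ b \<ge> 1" "n > 0" using m0 n by auto
  have den: "1 + (real m - 1) * real a > 0" using m by (intro add_pos_nonneg) auto
  hence w1: "w1 > 0" "w1 * (1 + (real m - 1) * real a) = 1" by (auto simp: w1_def)
  \<comment> \<open>\<open>g\<close> is \<open>w\<close> with indices from 0 and without the cutoff
    at \<open>n div m\<close>. It is also the uniform formula
    \<open>w1 * m powr (1 - \<lceil>log m (i + 1)\<rceil>)\<close>: at \<open>i = 0\<close> the
    ceiling is 0, which gives \<open>m * w1\<close>.\<close>
  define g where "g i = (if i = 0 then real m * w1 else wp (i + 1))" for i
  \<comment> \<open>The two spectra agree blockwise: the eigenvalue of index \<open>i\<close> on the maximally mixed side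
    splits into \<open>m\<close> equal parts, which are the entries of \<open>W'\<close> of index \<open>i * m, ..., i * m + m - 1\<close>.\<close>
  have wp_div: "g (i div m) / real m = wp (i + 1)" for i
  proof (cases "i < m")
    case True
    have "wp (i + 1) = w1"
    proof (cases "i = 0")
      case False
      have "\<lceil>log (real m) (real (i + 1))\<rceil> = int 0 + 1"
        by (rule ceiling_log_nat_eq_if) (use m True False in auto)
      thus ?thesis using False m0 by (simp add: wp_def)
    qed (simp add: wp_def)
    thus ?thesis using True m0 by (simp add: g_def)
  next
    case False
    hence "i div m \<noteq> 0" "i \<noteq> 0" using m0 by (auto simp: div_eq_0_iff)
    thus ?thesis using ceiling_log_Suc_div[OF m, of i] False m0
      by (simp add: g_def wp_def powr_diff powr_add powr_minus_divide)
  qed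
  have sum_g: "(\<Sum>i<m ^ j. g i) = (\<Sum>i<m ^ Suc j. wp (i + 1))" for j
  proof -
    have "(\<Sum>i<m ^ Suc j. wp (i + 1)) = (\<Sum>i<m ^ j * m. g (i div m) / real m)"
      by (simp only: wp_div power_Suc2)
    also have "\<dots> = (\<Sum>i<m ^ j. g i)"
      using m0 sum_div_mod[of "\<lambda>i j. g i / real m" m "m ^ j"] by simp
    finally show ?thesis by simp
  qed
  have head: "(\<Sum>i<k. f i) = f 0 + (\<Sum>i = 1..<k. f i)" if "k > 0" for f :: "nat \<Rightarrow> real" and k
    using that by (simp add: atLeast0LessThan[symmetric] sum.atLeast_Suc_lessThan)
  have wp1: "wp (Suc 0) = w1" by (simp add: wp_def)
  have sum_g': "(\<Sum>i<m ^ j. g i) = (\<Sum>i<m ^ j. wp (i + 1)) + (real m - 1) * w1" for j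
    using m0 by (simp add: head g_def wp1 algebra_simps)
  \<comment> \<open>By the block identity, the first \<open>m ^ Suc j\<close> values of
    \<open>wp\<close> have the same sum as the first \<open>m ^ j\<close> values of
    \<open>g\<close>, and \<open>g\<close> exceeds the shifted \<open>wp\<close> only at 0, by
    \<open>(m - 1) * w1\<close>. So each factor \<open>m\<close> adds that amount, and
    \<open>j = a\<close> explains the normalization in \<open>w1\<close>.\<close>
  have "(\<Sum>i<m ^ j. wp (i + 1)) = w1 * (1 + (real m - 1) * real j)" for j
  proof (induction j)
    case 0
    show ?case by (simp add: wp_def)
  next
    case (Suc j)
    thus ?case using sum_g[of j] sum_g'[of j] by (simp add: algebra_simps)
  qed
  hence sum_wp: "(\<Sum>i<n. wp (i + 1)) = 1" using w1 by (simp add: n)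
  have w_g: "w (i + 1) = (if i < m ^ b then g i else 0)" for i
    using mb by (simp add: w_def g_def nm Suc_le_eq)
  have "(\<Sum>i<n. w (i + 1)) = (\<Sum>i\<in>{..<n} \<inter> {i. i < m ^ b}. g i)"
    by (simp only: w_g) (simp add: sum.If_cases)
  also have "{..<n} \<inter> {i. i < m ^ b} = {..<m ^ b}"
    using m0 mb by (auto simp: nb intro: less_le_trans)
  \<comment> \<open>The support of \<open>w\<close> has length \<open>m ^ b\<close> with
    \<open>a = Suc b\<close>, so the block identity at \<open>b\<close> equates its total with the
    total of \<open>wp\<close> up to \<open>n\<close>.\<close>
  finally have sum_w: "(\<Sum>i<n. w (i + 1)) = 1" using sum_g[of b] sum_wp by (simp add: n b)
  have wp_pos: "wp i \<ge> 0" for i using w1 by (simp add: wp_def)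
  have w_pos: "w i \<ge> 0" for i using w1 wp_pos by (simp add: w_def)
  show "density_mat n W" unfolding W_def by (rule density_mat_mat_diag[OF w_pos sum_w])
  show "density_mat n W'" unfolding W'_def by (rule density_mat_mat_diag[OF wp_pos sum_wp])
  show "majorizes (kron W ((1 / of_nat m) \<cdot>\<^sub>m 1\<^sub>m m)) (kron W' (ket0_proj m))"
    unfolding W_def W'_def
  proof (rule majorizes_mat_diagI[OF m0])
    show "w (i div m + 1) / real m = wp (i + 1)" if "i < n" for i
      using that m0 wp_div[of i] by (simp only: w_g) (simp add: nb div_less_iff_less_mult)
    show "w (i div m + 1) = 0" if "n \<le> i" for i
      using that m0 by (simp only: w_g) (simp add: nb div_less_iff_less_mult)
  qed
  have "W - W' = mat_diag n (\<lambda>j. complex_of_real (w (j + 1) - wp (j + 1)))"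
    by (rule eq_matI) (auto simp: W_def W'_def)
  hence "trace_dist W W' = (\<Sum>j<n. \<bar>w (j + 1) - wp (j + 1)\<bar>) / 2"
    by (simp only: trace_dist_def trace_norm_mat_diag)
  \<comment> \<open>Only at index 0 does \<open>w\<close> exceed \<open>wp\<close>. Writing every
    term as \<open>wp - w\<close> and correcting that single sign by twice its size lets the two
    unit traces cancel.\<close>
  also have "(\<Sum>j<n. \<bar>w (j + 1) - wp (j + 1)\<bar>)
      = (\<Sum>j<n. (wp (j + 1) - w (j + 1)) + (if j = 0 then 2 * (real m - 1) * w1 else 0))"
  proof (rule sum.cong[OF refl])
    fix j
    show "\<bar>w (j + 1) - wp (j + 1)\<bar>
        = (wp (j + 1) - w (j + 1)) + (if j = 0 then 2 * (real m - 1) * w1 else 0)"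
    proof (cases "j = 0")
      case True
      have "real m * w1 - w1 = (real m - 1) * w1" by (simp add: algebra_simps)
      moreover have "\<dots> \<ge> 0" using m w1 by simp
      ultimately show ?thesis using True by (simp add: w_def wp_def algebra_simps)
    next
      case False
      thus ?thesis using wp_pos[of "j + 1"] by (simp add: w_def)
    qed
  qed
  also have "\<dots> = 2 * (real m - 1) * w1"
    using sum_w sum_wp mb by (simp add: sum.distrib sum_subtractf sum.delta)
  also have "2 * (real m - 1) * w1 / 2 = (real m - 1) * w1" by simp
  finally show "trace_dist W W' = (real m - 1) / (1 + (real m - 1) * real a)" by (simp add: w1_def)
  have "log (real m) (real n) = real a" using m by (simp add: n log_nat_power)
  thus "(real m - 1) / (1 + (real m - 1) * real a)
      = (real m - 1) / (1 + (real m - 1) * log (real m) (real n))" by simp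
next
  fix A B
  assume "density_mat n A \<and> density_mat n B \<and>
    majorizes (kron A ((1 / of_nat m) \<cdot>\<^sub>m 1\<^sub>m m)) (kron B (ket0_proj m))"
  thus "(real m - 1) / (1 + (real m - 1) * real a) \<le> trace_dist A B"
    using trace_dist_lower_bound[OF assms(1,3)] by blast
qed

end
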